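(* Let $X$ be a compact metrizable space, let $f:X\to X$ be an expansive homeomorphism, and let $q\ge1$. If $\mu$ is an $f$-invariant Borel probability measure such that $D^+_\mu(q)>0$ with respect to a hyperbolic metric on $X$ for $f$, then $h(f)\ge h_\mu(f)>0$, where $h(f)$ and $h_\mu(f)$ denote the topological entropy of $f$ and the metric entropy of $(f,\mu)$, respectively.
   Context: A homeomorphism $f$ of a metrizable space $X$ is expansive if, for a metric $\rho$ inducing the topology of $X$, there is $\delta>0$ such that for each pair of different points $x,y\in X$ there is $n\in\mathbb{Z}$ with $\rho(f^n(x),f^n(y))>\delta$. Hyperbolic metric: a metric $d$ compatible with the topology of $X$ such that there are numbers $k>1$ and $\varepsilon>0$ with $$\max\{d(f(x),f(y)),d(f^{-1}(x),f^{-1}(y))\}\ge\min\{k\,d(x,y),\varepsilon\}\quad\text{for all }x,y\in X,$$ and such that both $f$ and $f^{-1}$ are Lipschitz for $d$. Upper generalized fractal dimension: for $q\ne1$, $D^+_\mu(q)=\limsup_{r\downarrow0}\frac{\log\int_{\operatorname{supp}(\mu)}\mu(B(x,r))^{q-1}d\mu(x)}{(q-1)\log r}$, and $D^+_\mu(1)=\limsup_{r\downarrow0}\frac{\int_{\operatorname{supp}(\mu)}\log\mu(B(x,r))\,d\mu(x)}{\log r}$, where $B(x,r)$ is the open ball of radius $r$ centered at $x$ in the metric under consideration and $\operatorname{supp}(\mu)$ is the topological support of $\mu$. *)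

theory Defs
  imports "HOL-Analysis.Analysis" "HOL-Probability.Probability_Measure"
begin

definition int_iterate :: "'a set \<Rightarrow> ('a \<Rightarrow> 'a) \<Rightarrow> int \<Rightarrow> 'a \<Rightarrow> 'a" where
  "int_iterate S f n =
     (if n \<ge> 0 then f ^^ nat n else (inv_into S f) ^^ nat (- n))"

text \<open>
  The metric is quantified existentially; on a compact space the property does not depend on
  the choice of a compatible metric. The equation \<open>mtopology_of m = X\<close> forces
  \<open>mspace m = topspace X\<close>.
\<close>

definition expansive_homeomorphism :: "'a topology \<Rightarrow> ('a \<Rightarrow> 'a) \<Rightarrow> bool" where
  "expansive_homeomorphism X f \<longleftrightarrow>
     homeomorphic_map X X f \<and>
     (\<exists>m. mtopology_of m = X \<and>
       (\<exists>\<delta>>0. \<forall>x\<in>topspace X. \<forall>y\<in>topspace X. x \<noteq> y \<longrightarrow>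
         (\<exists>n::int. mdist m (int_iterate (topspace X) f n x) (int_iterate (topspace X) f n y) > \<delta>)))"

definition hyperbolic_metric :: "'a topology \<Rightarrow> ('a \<Rightarrow> 'a) \<Rightarrow> 'a metric \<Rightarrow> bool" where
  "hyperbolic_metric X f m \<longleftrightarrow>
     mtopology_of m = X \<and>
     (\<exists>k>1. \<exists>\<epsilon>>0. \<forall>x\<in>topspace X. \<forall>y\<in>topspace X.
        max (mdist m (f x) (f y))
            (mdist m (inv_into (topspace X) f x) (inv_into (topspace X) f y))
          \<ge> min (k * mdist m x y) \<epsilon>) \<and>
     Lipschitz_continuous_map m m f \<and>
     Lipschitz_continuous_map m m (inv_into (topspace X) f)"

definition borel_of :: "'a topology \<Rightarrow> 'a measure" where
  "borel_of X = sigma (topspace X) {U. openin X U}"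

definition invariant_measure :: "('a \<Rightarrow> 'a) \<Rightarrow> 'a measure \<Rightarrow> bool" where
  "invariant_measure f \<mu> \<longleftrightarrow>
     f \<in> measurable \<mu> \<mu> \<and>
     (\<forall>A\<in>sets \<mu>. emeasure \<mu> (f -` A \<inter> space \<mu>) = emeasure \<mu> A)"

definition topological_support :: "'a topology \<Rightarrow> 'a measure \<Rightarrow> 'a set" where
  "topological_support X \<mu> =
     {x \<in> topspace X. \<forall>U. openin X U \<and> x \<in> U \<longrightarrow> emeasure \<mu> U > 0}"

text \<open>
  For a Borel probability measure on a compact metric space and a fixed \<open>r > 0\<close>, the number
  \<open>\<mu>(B(x,r))\<close> is bounded away from 0 on the support, so the real-valued integrals below exist
  and the one inside the logarithm is positive. The upper limit is taken in the extended reals.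
\<close>

definition upper_fractal_dim :: "'a metric \<Rightarrow> 'a measure \<Rightarrow> real \<Rightarrow> ereal" where
  "upper_fractal_dim m \<mu> q =
     (if q = 1 then
        Limsup (at_right (0::real)) (\<lambda>r. ereal (
          (LINT x:topological_support (mtopology_of m) \<mu>|\<mu>. ln (measure \<mu> (mball_of m x r)))
          / ln r))
      else
        Limsup (at_right (0::real)) (\<lambda>r. ereal (
          ln (LINT x:topological_support (mtopology_of m) \<mu>|\<mu>.
                measure \<mu> (mball_of m x r) powr (q - 1))
          / ((q - 1) * ln r))))"

text \<open>
  The join of \<open>P, f\<inverse>P, \<dots>\<close> (\<open>n\<close> terms, pullbacks under iterates of \<open>f\<close>) on \<open>S\<close>,
  for \<open>P\<close> a cover or a partition of \<open>S\<close>. It may contain the empty set, which is harmless in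
  both uses below.
\<close>

definition dynamical_join :: "'a set \<Rightarrow> ('a \<Rightarrow> 'a) \<Rightarrow> 'a set set \<Rightarrow> nat \<Rightarrow> 'a set set" where
  "dynamical_join S f P n =
     {{x \<in> S. \<forall>i<n. (f ^^ i) x \<in> A i} | A. \<forall>i<n. A i \<in> P}"

definition open_cover :: "'a topology \<Rightarrow> 'a set set \<Rightarrow> bool" where
  "open_cover X \<U> \<longleftrightarrow> (\<forall>U\<in>\<U>. openin X U) \<and> \<Union>\<U> = topspace X"

definition min_subcover_card :: "'a set \<Rightarrow> 'a set set \<Rightarrow> nat" where
  "min_subcover_card S \<U> = (LEAST n. \<exists>\<V>\<subseteq>\<U>. finite \<V> \<and> \<Union>\<V> = S \<and> card \<V> = n)"

text \<open>
  Topological entropy by open covers (Adler, Konheim, McAndrew) and measure-theoretic entropy by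
  finite measurable partitions (Kolmogorov, Sinai). For continuous \<open>f\<close> on a compact space,
  respectively an invariant probability measure, and a fixed cover, respectively partition, the
  sequence before division by \<open>n\<close> is subadditive, so each upper limit is a limit.
\<close>

definition topological_entropy :: "'a topology \<Rightarrow> ('a \<Rightarrow> 'a) \<Rightarrow> ereal" where
  "topological_entropy X f =
     (SUP \<U>\<in>{\<U>. open_cover X \<U>}.
        limsup (\<lambda>n. ereal (
          ln (real (min_subcover_card (topspace X) (dynamical_join (topspace X) f \<U> n))) / real n)))"

text \<open>The convention \<open>0 log 0 = 0\<close> holds because of the factor 0.\<close>

definition partition_entropy :: "'a measure \<Rightarrow> 'a set set \<Rightarrow> real" where
  "partition_entropy \<mu> P = - (\<Sum>A\<in>P. measure \<mu> A * ln (measure \<mu> A))"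

definition metric_entropy :: "'a measure \<Rightarrow> ('a \<Rightarrow> 'a) \<Rightarrow> ereal" where
  "metric_entropy \<mu> f =
     (SUP P\<in>{P. finite P \<and> P \<subseteq> sets \<mu> \<and> partition_on (space \<mu>) P}.
        limsup (\<lambda>n. ereal (
          partition_entropy \<mu> (dynamical_join (space \<mu>) f P n) / real n)))"

end

theory Submission
  imports Defs
begin

text \<open>
  Positivity: if \<open>P\<close> is a partition of diameter less than \<open>\<epsilon>\<close>, then two points that share their
  \<open>P\<close>-itinerary at the times \<open>-n, \<dots>, n\<close> are at distance less than \<open>\<epsilon> k\<^sup>-\<^sup>n\<close> in the hyperbolic metric.
  So balls of that radius contain cells of the join of length \<open>2n + 1\<close>, and
  \<open>- \<integral> ln \<mu>(B(x,r)) d\<mu>\<close> is at most the entropy of that join; Jensen's inequality reduces \<open>q > 1\<close> to this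
  case. If \<open>h\<^sub>\<mu>(f)\<close> vanished, the entropy of the join would be \<open>o(n)\<close> and the dimension would be \<open>0\<close>.

  Half of the variational principle: given \<open>P\<close>, shrink each \<open>A \<in> P\<close> to a closed \<open>K A\<close> that loses little
  measure, and take the open cover by the complements of \<open>\<Union>\<^bsub>C \<noteq> A\<^esub> K C\<close>. A member of the dynamical join
  of this cover predicts the \<open>P\<close>-itinerary of its points except at visits to the small set outside all
  \<open>K A\<close>. The cross entropy relative to "choose a member of a minimal subcover, then perturb the
  prediction with a small probability" bounds the entropy of the join of \<open>P\<close> directly, without passing
  to powers of \<open>f\<close>.
\<close>

section \<open>Itinerary cells and the Gibbs inequality\<close>

definition itinerary_cell :: "'a set \<Rightarrow> ('a \<Rightarrow> 'a) \<Rightarrow> nat \<Rightarrow> (nat \<Rightarrow> 'a set) \<Rightarrow> 'a set" where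
  "itinerary_cell S f n a = {x \<in> S. \<forall>i<n. (f ^^ i) x \<in> a i}"

text \<open>A cell depends only on the values of its name below \<open>n\<close>, so names may be
  cut off there. This leaves a finite product set of names; sums over names, unlike sums over the
  sets of the join, factorize over times.\<close>

lemma dynamical_join_eq_cells:
  "dynamical_join S f P n = itinerary_cell S f n ` PiE {..<n} (\<lambda>_. P)"
proof
  show "dynamical_join S f P n \<subseteq> itinerary_cell S f n ` PiE {..<n} (\<lambda>_. P)"
  proof
    fix C assume "C \<in> dynamical_join S f P n"
    then obtain A where A: "C = {x \<in> S. \<forall>i<n. (f ^^ i) x \<in> A i}" "\<forall>i<n. A i \<in> P"
      by (auto simp: dynamical_join_def)
    then have "C = itinerary_cell S f n (restrict A {..<n})"
      by (auto simp: itinerary_cell_def)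
    with A(2) show "C \<in> itinerary_cell S f n ` PiE {..<n} (\<lambda>_. P)"
      by (intro image_eqI[where x = "restrict A {..<n}"]) auto
  qed
qed (auto simp: dynamical_join_def itinerary_cell_def PiE_def Pi_def)

lemma finite_dynamical_join: "finite P \<Longrightarrow> finite (dynamical_join S f P n)"
  by (simp add: dynamical_join_eq_cells finite_PiE)

lemma funpow_mem: "f ` S \<subseteq> S \<Longrightarrow> x \<in> S \<Longrightarrow> (f ^^ i) x \<in> S"
  by (induction i) auto

lemma itinerary_cell_disjoint:
  assumes "disjoint P" "a \<in> PiE {..<n} (\<lambda>_. P)" "b \<in> PiE {..<n} (\<lambda>_. P)"
    and "x \<in> itinerary_cell S f n a" "x \<in> itinerary_cell S f n b"
  shows "a = b"
proof (rule PiE_ext[OF assms(2,3)])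
  fix i assume "i \<in> {..<n}"
  with assms have "a i \<in> P" "b i \<in> P" "(f ^^ i) x \<in> a i \<inter> b i"
    by (auto simp: itinerary_cell_def)
  with assms(1) show "a i = b i" by (auto simp: disjoint_def)
qed

lemma itinerary_cell_covers:
  assumes "\<Union>P = S" "f ` S \<subseteq> S" "x \<in> S"
  obtains a where "a \<in> PiE {..<n} (\<lambda>_. P)" "x \<in> itinerary_cell S f n a"
proof -
  have "\<exists>A\<in>P. (f ^^ i) x \<in> A" for i
    using funpow_mem[OF assms(2,3), of i] assms(1) by auto
  then obtain A where "\<And>i. A i \<in> P" "\<And>i. (f ^^ i) x \<in> A i" by metis
  then show ?thesis using assms(3)
    by (intro that[of "restrict A {..<n}"]) (auto simp: itinerary_cell_def)
qed

text \<open>Sum of the pointwise inequality \<open>ln t \<le> t - 1\<close> at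
  \<open>t = q i / p i\<close>, weighted by \<open>p i\<close>. The total of \<open>q\<close> enters
  only through its upper bound, so reference weights may be subprobabilities.\<close>

lemma gibbs_inequality:
  fixes p q :: "'i \<Rightarrow> real"
  assumes "finite I" "\<And>i. i \<in> I \<Longrightarrow> p i \<ge> 0" "\<And>i. i \<in> I \<Longrightarrow> q i > 0"
    and "sum p I = 1" "sum q I \<le> 1"
  shows "- (\<Sum>i\<in>I. p i * ln (p i)) \<le> (\<Sum>i\<in>I. p i * - ln (q i))"
proof -
  have "p i * ln (q i) - p i * ln (p i) \<le> q i - p i" if "i \<in> I" for i
  proof (cases "p i = 0")
    case True
    then show ?thesis using assms(3)[OF that] by simp
  next
    case False
    with assms(2)[OF that] have p: "p i > 0" by simp
    have "p i * (ln (q i) - ln (p i)) \<le> p i * (q i / p i - 1)"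
      using ln_le_minus_one[of "q i / p i"] p assms(3)[OF that]
      by (intro mult_left_mono) (auto simp: ln_div)
    also have "\<dots> = q i - p i" using p by (simp add: field_simps)
    finally show ?thesis by (simp add: algebra_simps)
  qed
  then have "(\<Sum>i\<in>I. p i * ln (q i) - p i * ln (p i)) \<le> (\<Sum>i\<in>I. q i - p i)"
    by (rule sum_mono)
  also have "\<dots> \<le> 0" using assms(4,5) by (simp add: sum_subtractf)
  finally show ?thesis by (simp add: sum_subtractf sum_negf)
qed

section \<open>Borel measures on metrizable spaces\<close>

lemma space_borel_of [simp]: "space (borel_of X) = topspace X"
  unfolding borel_of_def by (rule space_measure_of) (auto dest: openin_subset)

lemma sets_borel_of: "sets (borel_of X) = sigma_sets (topspace X) {U. openin X U}"
  unfolding borel_of_def by (rule sets_measure_of) (auto dest: openin_subset)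

lemma openin_sets_borel_of: "openin X U \<Longrightarrow> U \<in> sets (borel_of X)"
  by (auto simp: sets_borel_of)

lemma closedin_sets_borel_of:
  assumes "closedin X K" shows "K \<in> sets (borel_of X)"
proof -
  have "openin X (topspace X - K)" using assms by auto
  then have "topspace X - (topspace X - K) \<in> sets (borel_of X)"
    unfolding sets_borel_of by (intro sigma_sets.Compl[OF sigma_sets.Basic] CollectI)
  moreover have "topspace X - (topspace X - K) = K"
    using closedin_subset[OF assms] by auto
  ultimately show ?thesis by simp
qed

text \<open>The sets that can be approximated by a closed set from inside and an open set from
  outside form a \<sigma>-algebra. It contains the open sets because open sets of a metrizable space
  are countable increasing unions of closed sets.\<close>

lemma borel_regular:
  assumes X: "metrizable_space X" and fin: "finite_measure \<mu>" and sets: "sets \<mu> = sets (borel_of X)"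
    and A: "A \<in> sets \<mu>" and e: "e > 0"
  obtains K U where "closedin X K" "openin X U" "K \<subseteq> A" "A \<subseteq> U" "measure \<mu> (U - K) < e"
proof -
  interpret finite_measure \<mu> by (rule fin)
  have op: "U \<in> sets \<mu>" if "openin X U" for U using that sets openin_sets_borel_of by auto
  have cl: "U \<in> sets \<mu>" if "closedin X U" for U using that sets closedin_sets_borel_of by auto
  let ?good = "\<lambda>A. \<forall>e>0. \<exists>K U. closedin X K \<and> openin X U \<and> K \<subseteq> A \<and> A \<subseteq> U \<and> measure \<mu> (U - K) < e"
  have "A \<in> sigma_sets (topspace X) {U. openin X U}" using A sets sets_borel_of by metis
  then have "?good A"
  proof induction
    case (Basic U)
    then have U: "openin X U" by simp
    obtain C where C: "\<And>n. closedin X (C n)" "\<And>n. C n \<subseteq> C (Suc n)" "\<Union> (range C) = U"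
      using open_imp_fsigma_in[OF X U] unfolding fsigma_in_ascending by metis
    have "(\<lambda>n. measure \<mu> (U - C n)) \<longlonglongrightarrow> measure \<mu> (\<Inter>n. U - C n)"
      using C op[OF U] cl by (intro finite_Lim_measure_decseq decseq_SucI) auto
    moreover have "(\<Inter>n. U - C n) = {}" using C by auto
    ultimately have lim: "(\<lambda>n. measure \<mu> (U - C n)) \<longlonglongrightarrow> 0"
      by (simp only: measure_empty)
    show ?case
    proof (intro allI impI)
      fix e :: real assume "e > 0"
      then have "eventually (\<lambda>n. measure \<mu> (U - C n) < e) sequentially"
        using lim by (auto dest: order_tendstoD)
      then obtain n where "measure \<mu> (U - C n) < e" by (auto simp: eventually_sequentially)
      then show "\<exists>K V. closedin X K \<and> openin X V \<and> K \<subseteq> U \<and> U \<subseteq> V \<and> measure \<mu> (V - K) < e"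
        using C U by (intro exI[of _ "C n"] exI[of _ U]) auto
    qed
  next
    case Empty
    then show ?case by (intro allI impI exI[of _ "{}"]) auto
  next
    case (Compl A)
    show ?case
    proof (intro allI impI)
      fix e :: real assume "e > 0"
      with Compl.IH obtain K U where KU: "closedin X K" "openin X U" "K \<subseteq> A" "A \<subseteq> U" "measure \<mu> (U - K) < e"
        by meson
      have "(topspace X - K) - (topspace X - U) = U - K"
        using openin_subset[OF KU(2)] by auto
      then show "\<exists>K V. closedin X K \<and> openin X V \<and> K \<subseteq> topspace X - A \<and> topspace X - A \<subseteq> V \<and> measure \<mu> (V - K) < e"
        using KU by (intro exI[of _ "topspace X - U"] exI[of _ "topspace X - K"]) auto
    qed
  next
    case (Union A)
    show ?case
    proof (intro allI impI)
      fix e :: real assume e: "e > 0"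
      \<comment> \<open>The errors add up to \<open>e / 2\<close>, which leaves room for replacing
        the union of all \<open>K i\<close> by a finite one.\<close>
      define Q where "Q i K U \<longleftrightarrow>
        closedin X K \<and> openin X U \<and> K \<subseteq> A i \<and> A i \<subseteq> U \<and> measure \<mu> (U - K) < e / 4 * (1/2) ^ i" for i K U
      have "\<exists>K U. Q i K U" for i
        unfolding Q_def by (rule Union.IH[rule_format]) (use e in simp)
      then obtain K U where Q: "\<And>i. Q i (K i) (U i)" by metis
      then have KU: "\<And>i. closedin X (K i)" "\<And>i. openin X (U i)" "\<And>i. K i \<subseteq> A i" "\<And>i. A i \<subseteq> U i"
          "\<And>i. measure \<mu> (U i - K i) < e / 4 * (1/2) ^ i" by (auto simp: Q_def)
      have Ks: "K i \<in> sets \<mu>" and Us: "U i \<in> sets \<mu>" for i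
        using cl[OF KU(1)] op[OF KU(2)] .
      define V where "V = \<Union>(range U)"
      \<comment> \<open>A countable union of closed sets need not be closed, whereas these finite
        unions are; continuity from above shows that some \<open>L n\<close> is good enough.\<close>
      define L where "L n = (\<Union>i<n. K i)" for n
      have V: "openin X V" unfolding V_def using KU by auto
      have L: "closedin X (L n)" for n unfolding L_def using KU by (auto intro!: closedin_Union)
      have sm: "summable (\<lambda>i. e / 4 * (1/2) ^ i)" by (intro summable_mult) (simp add: summable_geometric)
      have sm': "summable (\<lambda>i. measure \<mu> (U i - K i))"
        by (rule summable_comparison_test[OF _ sm]) (use KU(5) in \<open>auto simp: less_imp_le\<close>)
      have "measure \<mu> (V - \<Union>(range K)) \<le> measure \<mu> (\<Union>i. U i - K i)"
        unfolding V_def using Ks Us by (intro finite_measure_mono) blast+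
      also have "\<dots> \<le> (\<Sum>i. measure \<mu> (U i - K i))"
        using Ks Us sm' by (intro finite_measure_subadditive_countably) blast+
      also have "\<dots> \<le> (\<Sum>i. e / 4 * (1/2) ^ i)"
        using KU(5) by (intro suminf_le sm sm') (simp add: less_imp_le)
      also have "\<dots> = e / 2" by (subst suminf_mult) (simp_all add: suminf_geometric summable_geometric)
      finally have *: "measure \<mu> (V - \<Union>(range K)) < e" using e by simp
      have "(\<lambda>n. measure \<mu> (V - L n)) \<longlonglongrightarrow> measure \<mu> (\<Inter>n. V - L n)"
        using op[OF V] cl[OF L] by (intro finite_Lim_measure_decseq decseq_SucI) (auto simp: L_def)
      moreover have "(\<Inter>n. V - L n) = V - \<Union>(range K)" unfolding L_def by auto
      ultimately have "eventually (\<lambda>n. measure \<mu> (V - L n) < e) sequentially"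
        using * by (auto dest: order_tendstoD)
      then obtain n where "measure \<mu> (V - L n) < e" by (auto simp: eventually_sequentially)
      moreover have "L n \<subseteq> \<Union>(range A)" "\<Union>(range A) \<subseteq> V"
        unfolding L_def V_def using subsetD[OF KU(3)] subsetD[OF KU(4)] by auto
      ultimately show "\<exists>K V. closedin X K \<and> openin X V \<and> K \<subseteq> \<Union>(range A) \<and> \<Union>(range A) \<subseteq> V \<and> measure \<mu> (V - K) < e"
        using V L[of n] by (intro exI[of _ "L n"] exI[of _ V] conjI)
    qed
  qed
  with e obtain K U where "closedin X K" "openin X U" "K \<subseteq> A" "A \<subseteq> U" "measure \<mu> (U - K) < e"
    by meson
  then show thesis by (rule that)
qed

text \<open>The complement of the support is the union of all open null sets, possibly uncountably
  many. A closed subset of this union is compact, hence covered by finitely many of them and null;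
  regularity carries this over to the union.\<close>

lemma null_sets_complement_support:
  assumes X: "compact_space X" "metrizable_space X" and fin: "finite_measure \<mu>"
    and sets: "sets \<mu> = sets (borel_of X)"
  shows "topspace X - topological_support X \<mu> \<in> null_sets \<mu>"
proof -
  interpret finite_measure \<mu> by (rule fin)
  define N where "N = {U. openin X U \<and> emeasure \<mu> U = 0}"
  have N: "topspace X - topological_support X \<mu> = \<Union>N"
    using openin_subset unfolding topological_support_def N_def
    by (auto simp: zero_less_iff_neq_zero)
  have opN: "openin X (\<Union>N)" by (auto simp: N_def)
  have op: "U \<in> sets \<mu>" if "openin X U" for U using that sets openin_sets_borel_of by auto
  have Nsets: "\<Union>N \<in> sets \<mu>" using op[OF opN] .
  have "measure \<mu> (\<Union>N) < e" if e: "e > 0" for e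
  proof -
    obtain K U where KU: "closedin X K" "openin X U" "K \<subseteq> \<Union>N" "\<Union>N \<subseteq> U" "measure \<mu> (U - K) < e"
      using borel_regular[OF X(2) fin sets Nsets e] by metis
    have "compactin X K" using X(1) KU(1) by (simp add: closedin_compact_space)
    then obtain F where F: "finite F" "F \<subseteq> N" "K \<subseteq> \<Union>F"
      using KU(3) unfolding compactin_def N_def by (metis (no_types, lifting) mem_Collect_eq)
    have "\<Union>F \<in> null_sets \<mu>"
      using F op by (intro null_sets_UN'[where N = id, simplified] countable_finite) (auto simp: N_def null_sets_def)
    then have "measure \<mu> (\<Union>F) = 0" by (simp add: measure_eq_0_null_sets)
    have Ks: "K \<in> sets \<mu>" using KU(1) sets closedin_sets_borel_of by auto
    have "measure \<mu> (\<Union>N) \<le> measure \<mu> ((U - K) \<union> \<Union>F)"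
      using KU F op[OF KU(2)] Ks \<open>\<Union>F \<in> null_sets \<mu>\<close> by (intro finite_measure_mono) auto
    also have "\<dots> \<le> measure \<mu> (U - K) + measure \<mu> (\<Union>F)"
      using op[OF KU(2)] Ks \<open>\<Union>F \<in> null_sets \<mu>\<close> by (intro measure_Un_le) auto
    finally show ?thesis using KU \<open>measure \<mu> (\<Union>F) = 0\<close> by simp
  qed
  then have "measure \<mu> (\<Union>N) = 0" by (metis less_irrefl measure_nonneg order_le_less)
  then show "topspace X - topological_support X \<mu> \<in> null_sets \<mu>"
    using Nsets N by (auto simp: null_sets_def emeasure_eq_measure)
qed

section \<open>Entropy of a partition along orbits\<close>

locale partitioned_system = prob_space \<mu> for \<mu> :: "'a measure" +
  fixes f :: "'a \<Rightarrow> 'a" and P :: "'a set set"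
  assumes invariant: "invariant_measure f \<mu>"
    and finite_P: "finite P" and P_sets: "P \<subseteq> sets \<mu>" and P_partition: "partition_on (space \<mu>) P"
begin

abbreviation names :: "nat \<Rightarrow> (nat \<Rightarrow> 'a set) set" where
  "names n \<equiv> PiE {..<n} (\<lambda>_. P)"

abbreviation cell :: "nat \<Rightarrow> (nat \<Rightarrow> 'a set) \<Rightarrow> 'a set" where
  "cell \<equiv> itinerary_cell (space \<mu>) f"

abbreviation join_entropy :: "nat \<Rightarrow> real" where
  "join_entropy n \<equiv> partition_entropy \<mu> (dynamical_join (space \<mu>) f P n)"

lemma finite_names: "finite (names n)"
  using finite_P by (intro finite_PiE) auto

lemma measurable_iterate [measurable]: "f ^^ i \<in> measurable \<mu> \<mu>"
  using invariant by (intro measurable_compose_n) (simp add: invariant_measure_def)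

lemma distr_iterate: "distr \<mu> \<mu> (f ^^ i) = \<mu>"
proof (induction i)
  case 0
  show ?case by (simp add: distr_id2 id_def)
next
  case (Suc i)
  have f: "f \<in> measurable \<mu> \<mu>" using measurable_iterate[of 1] by (simp add: eta_contract_eq)
  have "distr \<mu> \<mu> f = \<mu>"
    using invariant f by (intro measure_eqI) (auto simp: invariant_measure_def emeasure_distr)
  then show ?case
    using distr_distr[OF f measurable_iterate[of i]] Suc by (simp add: o_def)
qed

lemma measure_vimage_iterate:
  "A \<in> sets \<mu> \<Longrightarrow> measure \<mu> ((f ^^ i) -` A \<inter> space \<mu>) = measure \<mu> A"
  using measure_distr[OF measurable_iterate, of A i] by (simp add: distr_iterate)

lemma f_space: "f ` space \<mu> \<subseteq> space \<mu>"
  using measurable_space[OF measurable_iterate[of 1]] by auto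

lemma sets_cell [measurable]: assumes "a \<in> names n" shows "cell n a \<in> sets \<mu>"
proof -
  have "a i \<in> sets \<mu>" if "i < n" for i using assms that P_sets by auto
  then have "(f ^^ i) -` a i \<inter> space \<mu> \<in> sets \<mu>" if "i < n" for i
    using that by (intro measurable_sets[OF measurable_iterate]) auto
  then have "{x \<in> space \<mu>. (f ^^ i) x \<in> a i} \<in> sets \<mu>" if "i < n" for i
    using that by (simp add: vimage_def Collect_conj_eq Int_commute)
  then have "{x \<in> space \<mu>. \<forall>i\<in>{..<n}. (f ^^ i) x \<in> a i} \<in> sets \<mu>"
    by (intro sets.sets_Collect_finite_All) auto
  then show ?thesis unfolding itinerary_cell_def Ball_def lessThan_iff .
qed

lemma cell_unique:
  assumes "a \<in> names n" "b \<in> names n" "x \<in> cell n a" "x \<in> cell n b"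
  shows "a = b"
  by (rule itinerary_cell_disjoint[OF partition_onD2[OF P_partition] assms])

lemma obtain_cell:
  assumes "x \<in> space \<mu>" obtains a where "a \<in> names n" "x \<in> cell n a"
  using itinerary_cell_covers[OF partition_onD1[OF P_partition, symmetric] f_space assms] that .

text \<open>The left side is the integral of the function with constant value \<open>w a\<close> on
  each cell. All integral estimates below go through this lemma, with \<open>w\<close> the logarithm
  of a weight or of the measure of a cell, up to affine changes.\<close>

lemma sum_cells_le_integral:
  fixes w :: "(nat \<Rightarrow> 'a set) \<Rightarrow> real"
  assumes \<phi>: "integrable \<mu> \<phi>"
    and le: "AE x in \<mu>. \<forall>a\<in>names n. x \<in> cell n a \<longrightarrow> w a \<le> \<phi> x"
  shows "(\<Sum>a\<in>names n. measure \<mu> (cell n a) * w a) \<le> integral\<^sup>L \<mu> \<phi>"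
proof -
  define h where "h x = (\<Sum>a\<in>names n. w a * indicator (cell n a) x)" for x
  have h: "h x = w a" if "a \<in> names n" "x \<in> cell n a" for x a
  proof -
    have "h x = (\<Sum>b\<in>names n. if b = a then w b else 0)"
      unfolding h_def
    proof (rule sum.cong[OF refl])
      fix b assume "b \<in> names n"
      from cell_unique[OF this that(1) _ that(2)] that(2)
      show "w b * indicator (cell n b) x = (if b = a then w b else 0)"
        by (cases "x \<in> cell n b") auto
    qed
    then show ?thesis using that(1) finite_names by simp
  qed
  have int: "integrable \<mu> h" unfolding h_def
    by (intro Bochner_Integration.integrable_sum integrable_mult_right integrable_real_indicator)
       (auto simp: emeasure_eq_measure)
  have "(\<Sum>a\<in>names n. measure \<mu> (cell n a) * w a) = integral\<^sup>L \<mu> h"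
    unfolding h_def
    by (subst Bochner_Integration.integral_sum)
       (auto intro!: sum.cong integrable_mult_right integrable_real_indicator simp: emeasure_eq_measure
          Int_absorb2 sets.sets_into_space)
  also have "\<dots> \<le> integral\<^sup>L \<mu> \<phi>"
  proof (intro integral_mono_AE int \<phi>)
    show "AE x in \<mu>. h x \<le> \<phi> x"
      using le AE_space
    proof eventually_elim
      case (elim x)
      obtain a where a: "a \<in> names n" "x \<in> cell n a" using obtain_cell[OF elim(2)] .
      with elim(1) show ?case using h[OF a] by simp
    qed
  qed
  finally show ?thesis .
qed

lemma sum_measure_cells: "(\<Sum>a\<in>names n. measure \<mu> (cell n a)) = 1"
proof -
  have "1 = measure \<mu> (\<Union>a\<in>names n. cell n a)"
  proof -
    have "(\<Union>a\<in>names n. cell n a) = space \<mu>"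
      using obtain_cell[of _ n] by (auto simp: itinerary_cell_def) metis
    then show ?thesis by (simp add: prob_space)
  qed
  also have "\<dots> = (\<Sum>a\<in>names n. measure \<mu> (cell n a))"
    using finite_names cell_unique
    by (intro finite_measure_finite_Union) (auto simp: disjoint_family_on_def)
  finally show ?thesis by simp
qed

text \<open>There are finitely many null cells. They have to be discarded before logarithms are
  compared, since \<open>ln 0 = 0\<close> breaks monotonicity.\<close>

lemma AE_cell_positive: "AE x in \<mu>. \<forall>a\<in>names n. x \<in> cell n a \<longrightarrow> measure \<mu> (cell n a) > 0"
proof (intro AE_finite_allI[OF finite_names])
  fix a assume a: "a \<in> names n"
  show "AE x in \<mu>. x \<in> cell n a \<longrightarrow> measure \<mu> (cell n a) > 0"
  proof (cases "measure \<mu> (cell n a) = 0")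
    case True
    then have "cell n a \<in> null_sets \<mu>" using a by (auto simp: null_sets_def emeasure_eq_measure)
    then show ?thesis using AE_not_in by fastforce
  next
    case False
    then show ?thesis by (simp add: zero_less_measure_iff)
  qed
qed

text \<open>Two names can have the same cell only if that cell is empty, and an empty cell
  contributes 0 to the sum.\<close>

lemma join_entropy_eq:
  "join_entropy n = - (\<Sum>a\<in>names n. measure \<mu> (cell n a) * ln (measure \<mu> (cell n a)))"
proof -
  have "(\<Sum>A\<in>cell n ` names n. measure \<mu> A * ln (measure \<mu> A)) =
      sum ((\<lambda>A. measure \<mu> A * ln (measure \<mu> A)) \<circ> cell n) (names n)"
  proof (rule sum.reindex_nontrivial[OF finite_names])
    fix a b assume ab: "a \<in> names n" "b \<in> names n" "a \<noteq> b" "cell n a = cell n b"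
    then have "cell n a = {}" using cell_unique by blast
    then show "measure \<mu> (cell n a) * ln (measure \<mu> (cell n a)) = 0" by simp
  qed
  then show ?thesis by (simp add: partition_entropy_def dynamical_join_eq_cells)
qed

lemma join_entropy_nonneg: "join_entropy n \<ge> 0"
proof -
  have "measure \<mu> (cell n a) * ln (measure \<mu> (cell n a)) \<le> 0" for a
  proof (cases "measure \<mu> (cell n a) = 0")
    case False
    then have "measure \<mu> (cell n a) > 0" by (simp add: zero_less_measure_iff)
    then show ?thesis by (intro mult_nonneg_nonpos) auto
  qed simp
  then show ?thesis by (simp add: join_entropy_eq sum_nonpos)
qed

text \<open>
  The reference weights: choose a set of the subcover uniformly, then let each symbol of the name
  agree with the corresponding index of that set with probability \<open>1 - \<delta>\<close>. A point whose name
  disagrees with the index at time \<open>i\<close> must have its \<open>i\<close>-th iterate outside all the \<open>K A\<close>.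
\<close>

lemma join_entropy_le_subcover:
  assumes K: "\<And>A. A \<in> P \<Longrightarrow> K A \<in> sets \<mu>" "\<And>A. A \<in> P \<Longrightarrow> K A \<subseteq> A"
    and \<tau>: "measure \<mu> (space \<mu> - \<Union>(K ` P)) \<le> \<tau>"
    and \<delta>: "0 < \<delta>" "\<delta> < 1"
  defines "\<U> \<equiv> (\<lambda>A. space \<mu> - \<Union>(K ` (P - {A}))) ` P"
  shows "join_entropy n \<le>
    ln (real (min_subcover_card (space \<mu>) (dynamical_join (space \<mu>) f \<U> n)))
      + real n * (- ln (1 - \<delta>) + \<tau> * ln (real (card P) / \<delta>))"
proof -
  define U where "U A = space \<mu> - \<Union>(K ` (P - {A}))" for A
  define B where "B = space \<mu> - \<Union>(K ` P)"
  define \<alpha> where "\<alpha> = - ln (1 - \<delta>)"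
  define \<beta> where "\<beta> = ln (real (card P) / \<delta>)"
  have "P \<noteq> {}" using P_partition not_empty by (auto simp: partition_on_def)
  then have cardP: "card P \<ge> 1" using finite_P by (simp add: Suc_le_eq card_gt_0_iff)
  have \<alpha>: "\<alpha> \<ge> 0" using \<delta> by (auto simp: \<alpha>_def)
  have "real (card P) / \<delta> \<ge> 1" using cardP \<delta> by (simp add: field_simps)
  then have \<beta>: "\<beta> \<ge> 0" by (simp add: \<beta>_def)
  have B_sets: "B \<in> sets \<mu>" unfolding B_def using K finite_P by auto
  let ?J = "dynamical_join (space \<mu>) f \<U> n"
  have \<U>: "\<U> = U ` P" by (simp add: \<U>_def U_def)
  have A_sub_U: "A \<subseteq> U A" if "A \<in> P" for A
    using that K(2) partition_onD1[OF P_partition] partition_onD2[OF P_partition]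
    by (fastforce simp: U_def disjoint_def)
  have cover: "\<Union>?J = space \<mu>"
  proof
    show "\<Union>?J \<subseteq> space \<mu>" by (auto simp: dynamical_join_def)
    show "space \<mu> \<subseteq> \<Union>?J"
    proof
      fix x assume "x \<in> space \<mu>"
      then obtain a where a: "a \<in> names n" "x \<in> cell n a" using obtain_cell by metis
      then have "x \<in> {x \<in> space \<mu>. \<forall>i<n. (f ^^ i) x \<in> U (a i)}"
        using A_sub_U by (fastforce simp: itinerary_cell_def)
      moreover have "{x \<in> space \<mu>. \<forall>i<n. (f ^^ i) x \<in> U (a i)} \<in> ?J"
        using a(1) unfolding dynamical_join_def \<U>
        by (intro CollectI exI[of _ "\<lambda>i. U (a i)"]) auto
      ultimately show "x \<in> \<Union>?J" by blast
    qed
  qed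
  have finJ: "finite ?J" using finite_P by (intro finite_dynamical_join) (simp add: \<U>)
  define N where "N = min_subcover_card (space \<mu>) ?J"
  \<comment> \<open>The join is itself a finite cover, so the least cardinality is attained.\<close>
  have "\<exists>\<V>\<subseteq>?J. finite \<V> \<and> \<Union>\<V> = space \<mu> \<and> card \<V> = N"
    unfolding N_def min_subcover_card_def by (rule LeastI[of _ "card ?J"]) (use cover finJ in auto)
  then obtain \<V> where \<V>: "\<V> \<subseteq> ?J" "finite \<V>" "\<Union>\<V> = space \<mu>" "card \<V> = N" by metis
  have "\<V> \<noteq> {}" using \<V>(3) not_empty by auto
  then have N: "N > 0" using \<V> by (auto simp: card_gt_0_iff)
  \<comment> \<open>A member of the subcover is only a set and may arise from several index
    sequences. One of them is fixed as the predicted name.\<close>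
  define indexed_by where "indexed_by V j \<longleftrightarrow>
    (\<forall>i<n. j i \<in> P) \<and> V = {x \<in> space \<mu>. \<forall>i<n. (f ^^ i) x \<in> U (j i)}" for V j
  have "\<exists>j. indexed_by V j" if V: "V \<in> \<V>" for V
  proof -
    obtain A where A: "V = {x \<in> space \<mu>. \<forall>i<n. (f ^^ i) x \<in> A i}" "\<forall>i<n. A i \<in> U ` P"
      using V \<V>(1) unfolding dynamical_join_def \<U> by blast
    then have "\<forall>i. \<exists>j. i < n \<longrightarrow> j \<in> P \<and> A i = U j" by auto
    then obtain j where "\<And>i. i < n \<Longrightarrow> j i \<in> P \<and> A i = U (j i)" by metis
    with A(1) show ?thesis unfolding indexed_by_def by (intro exI[of _ j]) auto
  qed
  then obtain j where "\<And>V. V \<in> \<V> \<Longrightarrow> indexed_by V (j V)" by metis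
  then have j: "\<And>V i. V \<in> \<V> \<Longrightarrow> i < n \<Longrightarrow> j V i \<in> P"
    "\<And>V. V \<in> \<V> \<Longrightarrow> V = {x \<in> space \<mu>. \<forall>i<n. (f ^^ i) x \<in> U (j V i)}"
    unfolding indexed_by_def by blast+
  \<comment> \<open>\<open>w A C\<close> is the weight of the symbol \<open>C\<close> when
    \<open>A\<close> is predicted. Each wrong symbol gets \<open>\<delta> / card P\<close>, so the
    total is slightly below 1, which the Gibbs inequality permits.\<close>
  define w where "w A C = (if C = A then 1 - \<delta> else \<delta> / real (card P))" for A C :: "'a set"
  have w_pos: "w A C > 0" for A C using \<delta> cardP by (auto simp: w_def)
  then have w_ne: "w A C \<noteq> 0" for A C by (metis less_irrefl)
  have w_sum: "(\<Sum>C\<in>P. w A C) \<le> 1" if "A \<in> P" for A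
  proof -
    have "(\<Sum>C\<in>P. w A C) = (1 - \<delta>) + (\<Sum>C\<in>P - {A}. \<delta> / real (card P))"
      using that finite_P by (subst sum.remove[of _ A]) (auto simp: w_def intro!: sum.cong)
    also have "(\<Sum>C\<in>P - {A}. \<delta> / real (card P)) \<le> (\<Sum>C\<in>P. \<delta> / real (card P))"
      using finite_P \<delta> by (intro sum_mono2) auto
    also have "\<dots> = \<delta>" using cardP by simp
    finally show ?thesis by simp
  qed
  define q where "q a = (\<Sum>V\<in>\<V>. \<Prod>i<n. w (j V i) (a i)) / real N" for a
  have q_pos: "q a > 0" for a unfolding q_def
    using N \<V>(2) \<open>\<V> \<noteq> {}\<close> w_pos by (intro divide_pos_pos sum_pos prod_pos) auto
  \<comment> \<open>Summing over all names turns each product of weights into a product of sums over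
    \<open>P\<close>, and each factor is at most 1.\<close>
  have "(\<Sum>a\<in>names n. q a) = (\<Sum>V\<in>\<V>. \<Sum>a\<in>names n. \<Prod>i<n. w (j V i) (a i)) / real N"
    unfolding q_def by (subst sum.swap) (simp add: sum_divide_distrib)
  also have "\<dots> = (\<Sum>V\<in>\<V>. \<Prod>i<n. \<Sum>C\<in>P. w (j V i) C) / real N"
    by (subst prod_sum_PiE) (use finite_P in auto)
  also have "\<dots> \<le> (\<Sum>V\<in>\<V>. 1) / real N"
    using w_sum j(1) w_pos
    by (intro divide_right_mono sum_mono prod_le_1) (auto intro!: sum_nonneg simp: less_imp_le)
  also have "\<dots> = 1" using N \<V>(4) by simp
  finally have q_sum: "(\<Sum>a\<in>names n. q a) \<le> 1" .
  \<comment> \<open>The cost of describing the name of \<open>x\<close>: \<open>ln N\<close> for the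
    member of the subcover, \<open>\<alpha>\<close> at each time, and an extra
    \<open>\<beta>\<close> at each visit to \<open>B\<close>. By invariance the mean number of
    visits is \<open>n\<close> times the measure of \<open>B\<close>.\<close>
  define \<phi> where "\<phi> x = ln (real N) + (\<Sum>i<n. \<alpha> + \<beta> * indicator B ((f ^^ i) x))" for x
  have le: "- ln (q a) \<le> \<phi> x" if a: "a \<in> names n" and x: "x \<in> cell n a" for a x
  proof -
    from x have xs: "x \<in> space \<mu>" by (simp add: itinerary_cell_def)
    then obtain V where V: "V \<in> \<V>" "x \<in> V" using \<V>(3) by blast
    have "- ln (w (j V i) (a i)) \<le> \<alpha> + \<beta> * indicator B ((f ^^ i) x)" if i: "i < n" for i
    proof (cases "a i = j V i")
      case True
      then show ?thesis using \<beta> by (simp add: w_def \<alpha>_def)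
    next
      case False
      let ?y = "(f ^^ i) x"
      have y: "?y \<in> space \<mu>" using funpow_mem[OF f_space xs] .
      have "?y \<in> a i" using x i by (simp add: itinerary_cell_def)
      have "?y \<in> U (j V i)" using V j(2)[OF V(1)] i by auto
      have "?y \<notin> K A" if "A \<in> P" for A
      proof
        assume yK: "?y \<in> K A"
        then have "?y \<in> A" using K(2) that by blast
        moreover have "a i \<in> P" using a i by auto
        ultimately have "A = a i"
          using \<open>?y \<in> a i\<close> that partition_onD2[OF P_partition] by (auto simp: disjoint_def)
        then show False using False \<open>?y \<in> U (j V i)\<close> yK that by (auto simp: U_def)
      qed
      then have "?y \<in> B" using y by (auto simp: B_def)
      moreover have "- ln (w (j V i) (a i)) = \<beta>"
        using False \<delta> cardP by (simp add: w_def \<beta>_def ln_div)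
      ultimately show ?thesis using \<alpha> by simp
    qed
    then have "(\<Sum>i<n. - ln (w (j V i) (a i))) \<le> (\<Sum>i<n. \<alpha> + \<beta> * indicator B ((f ^^ i) x))"
      by (intro sum_mono) auto
    moreover have "ln (\<Prod>i<n. w (j V i) (a i)) = (\<Sum>i<n. ln (w (j V i) (a i)))"
      using w_ne by (subst ln_prod) auto
    moreover have pr: "(\<Prod>i<n. w (j V i) (a i)) > 0" using w_pos by (intro prod_pos) auto
    then have "ln ((\<Prod>i<n. w (j V i) (a i)) / real N) = ln (\<Prod>i<n. w (j V i) (a i)) - ln (real N)"
      using N by (intro ln_divide_pos) auto
    ultimately have "- ln ((\<Prod>i<n. w (j V i) (a i)) / real N) \<le> \<phi> x"
      by (simp add: \<phi>_def sum_negf)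
    \<comment> \<open>Only the term of a member \<open>V\<close> containing \<open>x\<close> is kept
      from the mixture \<open>q a\<close>.\<close>
    moreover have "(\<Prod>i<n. w (j V i) (a i)) / real N \<le> q a" unfolding q_def
      using V \<V>(2) w_pos by (intro divide_right_mono member_le_sum prod_nonneg) (auto simp: less_imp_le)
    then have "ln ((\<Prod>i<n. w (j V i) (a i)) / real N) \<le> ln (q a)"
      using N q_pos pr by (subst ln_le_cancel_iff) (auto intro!: divide_pos_pos)
    ultimately show ?thesis by simp
  qed
  have int: "integrable \<mu> (\<lambda>x. indicator B ((f ^^ i) x) :: real)" for i
    using integrable_distr[OF measurable_iterate[of i], where f = "indicator B :: _ \<Rightarrow> real"] B_sets
    by (simp add: distr_iterate emeasure_eq_measure)
  have int_eq: "(\<integral>x. indicator B ((f ^^ i) x) \<partial>\<mu>) = measure \<mu> B" for i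
    using integral_distr[OF measurable_iterate[of i], where f = "indicator B :: _ \<Rightarrow> real"] B_sets
    by (simp add: distr_iterate Int_absorb2 sets.sets_into_space)
  have \<phi>: "integrable \<mu> \<phi>" unfolding \<phi>_def
    using int by (intro Bochner_Integration.integrable_add Bochner_Integration.integrable_sum) auto
  have "join_entropy n \<le> (\<Sum>a\<in>names n. measure \<mu> (cell n a) * - ln (q a))"
    unfolding join_entropy_eq
    by (rule gibbs_inequality[OF finite_names]) (use q_pos q_sum sum_measure_cells in auto)
  also have "\<dots> \<le> integral\<^sup>L \<mu> \<phi>"
    by (rule sum_cells_le_integral[OF \<phi>]) (use le in auto)
  also have "\<dots> = ln (real N) + real n * (\<alpha> + \<beta> * measure \<mu> B)"
    unfolding \<phi>_def using int int_eq by (simp add: prob_space)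
  also have "\<dots> \<le> ln (real N) + real n * (\<alpha> + \<tau> * \<beta>)"
    using \<tau> \<beta> by (intro add_left_mono mult_left_mono) (auto simp: B_def mult.commute intro: mult_left_mono)
  finally show ?thesis by (simp add: N_def \<alpha>_def \<beta>_def)
qed

end

section \<open>Metric entropy is at most topological entropy\<close>

lemma metric_entropy_le_topological_entropy:
  assumes X: "metrizable_space X" and prob: "prob_space \<mu>" and sets: "sets \<mu> = sets (borel_of X)"
    and inv: "invariant_measure f \<mu>"
  shows "metric_entropy \<mu> f \<le> topological_entropy X f"
  unfolding metric_entropy_def
proof (rule SUP_least, clarify)
  fix P assume P: "finite P" "P \<subseteq> sets \<mu>" "partition_on (space \<mu>) P"
  interpret prob_space \<mu> by (rule prob)
  interpret partitioned_system \<mu> f P using P inv by unfold_locales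
  have sp: "space \<mu> = topspace X" using sets_eq_imp_space_eq[OF sets] by simp
  have "P \<noteq> {}" using P_partition not_empty by (auto simp: partition_on_def)
  then have cardP: "real (card P) > 0" using finite_P by (simp add: card_gt_0_iff)
  show "limsup (\<lambda>n. ereal (join_entropy n / real n)) \<le> topological_entropy X f"
  proof (rule ereal_le_epsilon2)
    fix \<eta> :: real assume \<eta>: "\<eta> > 0"
    \<comment> \<open>With this \<open>\<delta>\<close>, \<open>- ln (1 - \<delta>)\<close> equals
      \<open>\<eta> / 2\<close>. Once \<open>\<delta>\<close> fixes \<open>\<beta>\<close>, the
      bound \<open>\<tau>\<close> on the exceptional measure is taken so small that visits to the
      exceptional set cost at most another \<open>\<eta> / 2\<close> per unit of time.\<close>
    define \<delta> where "\<delta> = 1 - exp (- \<eta> / 2)"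
    have \<delta>: "0 < \<delta>" "\<delta> < 1" using \<eta> by (auto simp: \<delta>_def)
    define \<beta> where "\<beta> = ln (real (card P) / \<delta>)"
    define \<tau> where "\<tau> = \<eta> / (2 * (\<bar>\<beta>\<bar> + 1))"
    have \<tau>: "\<tau> > 0" using \<eta> by (auto simp: \<tau>_def intro!: divide_pos_pos add_nonneg_pos)
    have "\<tau> * \<beta> \<le> \<tau> * (\<bar>\<beta>\<bar> + 1)" using \<tau> by (intro mult_left_mono) auto
    also have "\<dots> = \<eta> / 2" unfolding \<tau>_def by (simp add: field_simps)
    finally have small: "- ln (1 - \<delta>) + \<tau> * \<beta> \<le> \<eta>" by (simp add: \<delta>_def)
    have "\<exists>K. closedin X K \<and> K \<subseteq> A \<and> measure \<mu> (A - K) < \<tau> / card P" if A: "A \<in> P" for A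
    proof -
      have "A \<in> sets \<mu>" "\<tau> / card P > 0" using A P_sets \<tau> cardP by auto
      then obtain K V where KV: "closedin X K" "openin X V" "K \<subseteq> A" "A \<subseteq> V" "measure \<mu> (V - K) < \<tau> / card P"
        using borel_regular[OF X finite_measure_axioms sets] by metis
      have "V \<in> sets \<mu>" "K \<in> sets \<mu>" using KV sets openin_sets_borel_of closedin_sets_borel_of by auto
      then have "measure \<mu> (A - K) \<le> measure \<mu> (V - K)"
        using KV by (intro finite_measure_mono) auto
      with KV show ?thesis by force
    qed
    then obtain K where K: "\<And>A. A \<in> P \<Longrightarrow> closedin X (K A)" "\<And>A. A \<in> P \<Longrightarrow> K A \<subseteq> A"
      "\<And>A. A \<in> P \<Longrightarrow> measure \<mu> (A - K A) < \<tau> / card P" by metis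
    have K_sets: "K A \<in> sets \<mu>" if "A \<in> P" for A
      using K(1)[OF that] sets closedin_sets_borel_of by auto
    have "measure \<mu> (space \<mu> - \<Union>(K ` P)) \<le> measure \<mu> (\<Union>A\<in>P. A - K A)"
      using finite_P P_sets K_sets partition_onD1[OF P_partition]
      by (intro finite_measure_mono) auto
    also have "\<dots> \<le> (\<Sum>A\<in>P. measure \<mu> (A - K A))"
      using finite_P P_sets K_sets by (intro measure_UNION_le) auto
    also have "\<dots> \<le> (\<Sum>A\<in>P. \<tau> / card P)" using K(3) by (intro sum_mono) (auto simp: less_imp_le)
    also have "\<dots> = \<tau>" using cardP by simp
    finally have B: "measure \<mu> (space \<mu> - \<Union>(K ` P)) \<le> \<tau>" .
    define \<U> where "\<U> = (\<lambda>A. space \<mu> - \<Union>(K ` (P - {A}))) ` P"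
    define L where "L n = ln (real (min_subcover_card (topspace X) (dynamical_join (topspace X) f \<U> n)))" for n
    have bound: "join_entropy n / real n \<le> L n / real n + \<eta>" if "n > 0" for n
    proof -
      have "join_entropy n \<le> L n + real n * (- ln (1 - \<delta>) + \<tau> * \<beta>)"
        using join_entropy_le_subcover[OF K_sets K(2) B \<delta>, of n] unfolding L_def \<U>_def \<beta>_def sp by simp
      also have "\<dots> \<le> L n + real n * \<eta>" using small by (intro add_left_mono mult_left_mono) auto
      finally show ?thesis using that by (simp add: field_simps)
    qed
    have "open_cover X \<U>" unfolding open_cover_def
    proof
      show "\<forall>U\<in>\<U>. openin X U" unfolding \<U>_def sp
        using K(1) finite_P by (auto intro!: openin_diff closedin_Union)
      show "\<Union>\<U> = topspace X"
      proof
        show "\<Union>\<U> \<subseteq> topspace X" by (auto simp: \<U>_def sp)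
        show "topspace X \<subseteq> \<Union>\<U>"
        proof
          fix x assume "x \<in> topspace X"
          then obtain A where A: "A \<in> P" "x \<in> A" using partition_onD1[OF P_partition] sp by auto
          then have "x \<notin> K C" if "C \<in> P - {A}" for C
            using that K(2)[of C] partition_onD2[OF P_partition] by (auto simp: disjoint_def)
          then show "x \<in> \<Union>\<U>" using A \<open>x \<in> topspace X\<close> by (auto simp: \<U>_def sp)
        qed
      qed
    qed
    have "limsup (\<lambda>n. ereal (join_entropy n / real n)) \<le> limsup (\<lambda>n. ereal (L n / real n) + ereal \<eta>)"
      by (rule Limsup_mono, rule eventually_mono[OF eventually_gt_at_top[of 0]]) (use bound in auto)
    also have "\<dots> = limsup (\<lambda>n. ereal (L n / real n)) + ereal \<eta>"
      by (rule Limsup_add_ereal_right) auto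
    also have "\<dots> \<le> topological_entropy X f + ereal \<eta>"
      unfolding topological_entropy_def L_def using \<open>open_cover X \<U>\<close>
      by (intro add_right_mono SUP_upper) auto
    finally show "limsup (\<lambda>n. ereal (join_entropy n / real n)) \<le> topological_entropy X f + ereal \<eta>" .
  qed
qed

section \<open>Hyperbolic metrics and fractal dimension\<close>

text \<open>As all terms are below \<open>\<epsilon>\<close>, the minimum in the expansion
  hypothesis cannot be \<open>\<epsilon>\<close>, so some neighbour of each inner term is at least
  \<open>k\<close> times that term. Moving to such neighbours from the middle position
  \<open>n\<close> allows \<open>n\<close> steps inside \<open>0, ..., 2 * n\<close>.\<close>

lemma hyperbolic_sequence_bound:
  fixes a :: "nat \<Rightarrow> real"
  assumes k: "k \<ge> 1"
    and expand: "\<And>i. 0 < i \<Longrightarrow> i < 2 * n \<Longrightarrow> min (k * a i) \<epsilon> \<le> max (a (Suc i)) (a (i - 1))"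
    and bound: "\<And>i. i \<le> 2 * n \<Longrightarrow> a i < \<epsilon>"
  shows "k ^ n * a n < \<epsilon>"
proof -
  have "\<exists>j. n - s \<le> j \<and> j \<le> n + s \<and> k ^ s * a n \<le> a j" if "s \<le> n" for s
    using that
  proof (induction s)
    case 0
    then show ?case by (intro exI[of _ n]) auto
  next
    case (Suc s)
    then obtain j where j: "n - s \<le> j" "j \<le> n + s" "k ^ s * a n \<le> a j" by auto
    with Suc.prems have j': "0 < j" "j < 2 * n" by auto
    then have "a (Suc j) < \<epsilon>" "a (j - 1) < \<epsilon>" by (auto intro!: bound)
    with expand[OF j'] have "k * a j \<le> a (Suc j) \<or> k * a j \<le> a (j - 1)" by linarith
    moreover have "k ^ Suc s * a n \<le> k * a j"
      using mult_left_mono[OF j(3), of k] k by (simp add: mult.assoc)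
    ultimately have "k ^ Suc s * a n \<le> a (Suc j) \<or> k ^ Suc s * a n \<le> a (j - 1)" by linarith
    then show ?case
    proof
      assume "k ^ Suc s * a n \<le> a (Suc j)"
      then show ?thesis using j by (intro exI[of _ "Suc j"]) auto
    next
      assume "k ^ Suc s * a n \<le> a (j - 1)"
      then show ?thesis using j j' by (intro exI[of _ "j - 1"]) auto
    qed
  qed
  from this[of n] obtain j where "j \<le> n + n" "k ^ n * a n \<le> a j" by auto
  with bound[of j] show ?thesis by simp
qed

lemma openin_mball_of: "openin (mtopology_of m) (mball_of m x r)"
  using Metric_space.openin_mball[OF Metric_space_mspace_mdist] by (simp add: mtopology_of_def mball_of_def)

text \<open>By total boundedness finitely many balls of radius \<open>\<epsilon> / 2\<close> cover
  the space. Removing from each ball the earlier ones makes them disjoint, and empty remainders are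
  dropped because a partition may not contain them.\<close>

lemma obtain_small_borel_partition:
  assumes X: "compact_space X" and m: "mtopology_of m = X" and \<epsilon>: "\<epsilon> > 0"
  obtains P where "finite P" "P \<subseteq> sets (borel_of X)" "partition_on (topspace X) P"
    "\<forall>A\<in>P. \<forall>x\<in>A. \<forall>y\<in>A. mdist m x y < \<epsilon>"
proof -
  interpret Metric_space "mspace m" "mdist m" by (rule Metric_space_mspace_mdist)
  have sp: "topspace X = mspace m" using m by auto
  have "compactin mtopology (mspace m)"
    using X m unfolding compact_space_def by (auto simp: mtopology_of_def)
  then have "mtotally_bounded (mspace m)" by (rule compactin_imp_mtotally_bounded)
  then obtain F where F: "finite F" "F \<subseteq> mspace m" "mspace m \<subseteq> (\<Union>x\<in>F. mball x (\<epsilon> / 2))"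
    using \<epsilon> unfolding mtotally_bounded_def by (metis half_gt_zero)
  obtain c where c: "bij_betw c {0..<card F} F" using ex_bij_betw_nat_finite[OF F(1)] by blast
  define B where "B i = mball (c i) (\<epsilon> / 2)" for i
  define P where "P = disjointed B ` {0..<card F} - {{}}"
  have B_sets: "B i \<in> sets (borel_of X)" for i
    unfolding B_def using openin_mball m by (intro openin_sets_borel_of) (auto simp: mtopology_of_def)
  have fin: "finite P" by (simp add: P_def)
  have P_sets: "P \<subseteq> sets (borel_of X)"
    unfolding P_def using sets.range_disjointed_sets[of B] B_sets by blast
  have "(\<Union>i\<in>{0..<card F}. disjointed B i) = (\<Union>i\<in>{0..<card F}. B i)"
    by (rule finite_UN_disjointed_eq)
  also have "\<dots> = (\<Union>x\<in>c ` {0..<card F}. mball x (\<epsilon> / 2))"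
    by (simp add: B_def)
  also have "\<dots> = (\<Union>x\<in>F. mball x (\<epsilon> / 2))"
    unfolding bij_betw_imp_surj_on[OF c] ..
  also have "\<dots> = mspace m" using F(3) by auto
  finally have U: "(\<Union>i\<in>{0..<card F}. disjointed B i) = mspace m" .
  have "\<Union>P = topspace X" unfolding P_def sp U[symmetric] by blast
  moreover have "disjoint P"
  proof (rule disjointI)
    fix A C assume "A \<in> P" "C \<in> P" "A \<noteq> C"
    then obtain i j where "A = disjointed B i" "C = disjointed B j" "i \<noteq> j" by (auto simp: P_def)
    then show "A \<inter> C = {}"
      using disjoint_family_onD[OF disjoint_family_disjointed[of B], of i j] by simp
  qed
  ultimately have part: "partition_on (topspace X) P"
    unfolding partition_on_def by (auto simp: P_def)
  have diam: "mdist m x y < \<epsilon>" if A: "A \<in> P" and xy: "x \<in> A" "y \<in> A" for A x y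
  proof -
    obtain i where "A = disjointed B i" using A by (auto simp: P_def)
    then have "x \<in> B i" "y \<in> B i" using xy disjointed_subset[of B i] by auto
    then show ?thesis unfolding B_def
      using triangle[of x "c i" y] commute[of x "c i"] by auto
  qed
  show thesis using that[OF fin P_sets part] diam by blast
qed

text \<open>The \<open>n\<close> that belongs to a radius \<open>r\<close> grows like
  \<open>- ln r / ln k\<close>, so \<open>H (2 * n + 1) = o(n)\<close> is also
  \<open>o(- ln r)\<close>. Since \<open>ln r < 0\<close>, a lower bound on \<open>J r\<close> is an
  upper bound on the quotient.\<close>

lemma Limsup_scaled_log_nonpos:
  fixes J :: "real \<Rightarrow> real" and H :: "nat \<Rightarrow> real"
  assumes k: "k > 1" and \<epsilon>: "\<epsilon> > 0"
    and J: "\<And>n r. r * k ^ n > \<epsilon> \<Longrightarrow> J r \<ge> - H (2 * n + 1)"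
    and H: "limsup (\<lambda>n. ereal (H n / real n)) \<le> 0"
  shows "Limsup (at_right 0) (\<lambda>r. ereal (J r / ln r)) \<le> 0"
proof (rule ereal_le_epsilon2)
  fix e :: real assume e: "e > 0"
  define C where "C = 2 / ln k + 1"
  have lnk: "ln k > 0" using k by simp
  have C: "C > 0" using lnk by (simp add: C_def add_pos_pos)
  define \<eta> where "\<eta> = e / C"
  have \<eta>: "\<eta> > 0" using e C by (simp add: \<eta>_def)
  have "limsup (\<lambda>n. ereal (H n / real n)) < ereal \<eta>" using H \<eta> by (simp add: order_le_less_trans zero_ereal_def)
  then have "eventually (\<lambda>n. ereal (H n / real n) < ereal \<eta>) sequentially" by (rule Limsup_lessD)
  then obtain N where N: "\<And>n. n \<ge> N \<Longrightarrow> H n / real n < \<eta>" by (auto simp: eventually_sequentially)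
  \<comment> \<open>With \<open>L = - ln r\<close>, the first bound forces \<open>n > N\<close>, the
    second \<open>L > 1\<close>, and the third lets \<open>L\<close> absorb the additive constant in
    \<open>2 * t + 3\<close>. The last of these accounts for the summand 1 in
    \<open>C\<close>.\<close>
  define r0 where "r0 = min (\<epsilon> / k ^ N) (min (exp (- 1)) (exp (- (2 * ln \<epsilon> / ln k + 3))))"
  have r0: "r0 > 0" using \<epsilon> k by (simp add: r0_def)
  have "J r / ln r \<le> e" if r: "0 < r" "r < r0" for r
  proof -
    define L where "L = - ln r"
    have "ln r < ln (exp (- (1::real)))" using r by (subst ln_less_cancel_iff) (auto simp: r0_def)
    then have L1: "L > 1" by (simp add: L_def)
    have "ln r < ln (exp (- (2 * ln \<epsilon> / ln k + 3)))" using r by (subst ln_less_cancel_iff) (auto simp: r0_def)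
    then have L2: "L > 2 * ln \<epsilon> / ln k + 3" by (simp add: L_def)
    have re: "r * k ^ N < \<epsilon>" using r k by (simp add: r0_def field_simps)
    define t where "t = (ln \<epsilon> + L) / ln k"
    have t: "t * ln k = ln \<epsilon> - ln r" using lnk by (simp add: t_def L_def)
    have "ln (r * k ^ N) < ln \<epsilon>" using re r \<epsilon> k by (subst ln_less_cancel_iff) auto
    then have "real N * ln k < t * ln k" using r k by (simp add: t ln_mult ln_realpow)
    then have tN: "real N < t" using lnk by simp
    \<comment> \<open>The least natural number above \<open>t\<close>, that is, the least
      \<open>n\<close> with \<open>r * k ^ n > \<epsilon>\<close>.\<close>
    define n where "n = nat \<lfloor>t\<rfloor> + 1"
    have n: "t < real n" "real n \<le> t + 1" using tN by (auto simp: n_def) linarith+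
    then have nN: "2 * n + 1 \<ge> N" using tN by simp
    have "ln \<epsilon> < ln (r * k ^ n)"
      using mult_strict_right_mono[OF n(1) lnk] r k by (simp add: t ln_mult ln_realpow)
    then have "r * k ^ n > \<epsilon>" using r \<epsilon> k by (subst (asm) ln_less_cancel_iff) auto
    from J[OF this] have "- J r \<le> H (2 * n + 1)" by simp
    also have "\<dots> \<le> \<eta> * real (2 * n + 1)" using N[OF nN] by (simp add: field_simps)
    also have "\<dots> \<le> \<eta> * (2 * t + 3)" using n \<eta> by (intro mult_left_mono) auto
    also have "2 * t + 3 = 2 * L / ln k + (2 * ln \<epsilon> / ln k + 3)"
      by (simp add: t_def add_divide_distrib algebra_simps)
    also have "\<eta> * (2 * L / ln k + (2 * ln \<epsilon> / ln k + 3)) \<le> \<eta> * (C * L)"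
      using L2 \<eta> by (intro mult_left_mono) (auto simp: C_def algebra_simps)
    also have "\<dots> = e * L" using C by (simp add: \<eta>_def)
    finally have "- J r \<le> e * L" .
    then have "- J r / L \<le> e" using L1 by (simp add: field_simps)
    then show ?thesis by (simp add: L_def)
  qed
  then have "eventually (\<lambda>r. ereal (J r / ln r) \<le> ereal e) (at_right 0)"
    using r0 by (auto simp: eventually_at_right_field)
  then show "Limsup (at_right 0) (\<lambda>r. ereal (J r / ln r)) \<le> 0 + ereal e"
    by (simp add: Limsup_bounded)
qed

section \<open>Comparison of balls with cells\<close>

context partitioned_system
begin

text \<open>The two-sided itinerary around a point is read forwards over the times
  \<open>0, ..., 2 * n\<close>, with the ball centred at the middle iterate. Orbits in one cell stay
  \<open>\<epsilon>\<close>-close at all these times, so expansion makes them closer than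
  \<open>\<epsilon> / k ^ n < r\<close> at time \<open>n\<close>.\<close>

lemma cell_subset_vimage_ball:
  assumes inj: "inj_on f (space \<mu>)" and sp: "mspace m = space \<mu>"
    and k: "k > 1"
    and expand: "\<And>x y. x \<in> space \<mu> \<Longrightarrow> y \<in> space \<mu> \<Longrightarrow>
      max (mdist m (f x) (f y)) (mdist m (inv_into (space \<mu>) f x) (inv_into (space \<mu>) f y))
        \<ge> min (k * mdist m x y) \<epsilon>"
    and diam: "\<And>A x y. A \<in> P \<Longrightarrow> x \<in> A \<Longrightarrow> y \<in> A \<Longrightarrow> mdist m x y < \<epsilon>"
    and a: "a \<in> names (2 * n + 1)" and x: "x \<in> cell (2 * n + 1) a"
    and r: "r * k ^ n > \<epsilon>"
  shows "cell (2 * n + 1) a \<subseteq> (f ^^ n) -` mball_of m ((f ^^ n) x) r \<inter> space \<mu>"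
proof
  fix y assume y: "y \<in> cell (2 * n + 1) a"
  have xs: "x \<in> space \<mu>" and ys: "y \<in> space \<mu>" using x y by (auto simp: itinerary_cell_def)
  have xi: "(f ^^ i) x \<in> space \<mu>" and yi: "(f ^^ i) y \<in> space \<mu>" for i
    using funpow_mem[OF f_space] xs ys by auto
  define d where "d i = mdist m ((f ^^ i) x) ((f ^^ i) y)" for i
  have "k ^ n * d n < \<epsilon>"
  proof (rule hyperbolic_sequence_bound)
    fix i assume i: "0 < i" "i < 2 * n"
    then obtain l where l: "i = Suc l" by (cases i) auto
    \<comment> \<open>Applying the inverse to an iterate at time \<open>i\<close> gives the iterate
      at time \<open>i - 1\<close>, so the hyperbolic inequality compares \<open>d i\<close> with
      its two neighbours.\<close>
    have "inv_into (space \<mu>) f ((f ^^ i) z) = (f ^^ l) z" if "(f ^^ l) z \<in> space \<mu>" for z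
      using inv_into_f_f[OF inj that] by (simp add: l)
    then show "min (k * d i) \<epsilon> \<le> max (d (Suc i)) (d (i - 1))"
      using expand[OF xi[of i] yi[of i]] xi yi by (simp add: d_def l)
  next
    fix i assume "i \<le> 2 * n"
    then have "a i \<in> P" "(f ^^ i) x \<in> a i" "(f ^^ i) y \<in> a i"
      using a x y by (auto simp: itinerary_cell_def)
    then show "d i < \<epsilon>" unfolding d_def by (rule diam)
  qed (use k in auto)
  also have "\<epsilon> < k ^ n * r" using r by (simp add: mult.commute)
  finally have "d n < r" using k by simp
  then show "y \<in> (f ^^ n) -` mball_of m ((f ^^ n) x) r \<inter> space \<mu>"
    using xi yi ys by (simp add: d_def sp)
qed

lemma integrable_iterate:
  fixes g :: "'a \<Rightarrow> real" assumes "integrable \<mu> g" shows "integrable \<mu> (\<lambda>x. g ((f ^^ n) x))"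
  using integrable_distr[OF measurable_iterate[of n], where f = g] assms by (simp add: distr_iterate)

lemma integral_iterate:
  fixes g :: "'a \<Rightarrow> real" assumes "integrable \<mu> g"
  shows "(\<integral>x. g ((f ^^ n) x) \<partial>\<mu>) = (\<integral>x. g x \<partial>\<mu>)"
  using integral_distr[OF measurable_iterate[of n], where f = g] assms by (simp add: distr_iterate)

text \<open>By invariance the integrand may be evaluated at the \<open>n\<close>-th iterate of
  \<open>x\<close>, and the ball there has at least the measure of the cell of
  \<open>x\<close>.\<close>

lemma integral_log_ge_join_entropy:
  assumes B: "\<And>x. B x \<in> sets \<mu>"
    and sub: "\<And>a x. a \<in> names N \<Longrightarrow> x \<in> cell N a \<Longrightarrow> cell N a \<subseteq> (f ^^ n) -` B ((f ^^ n) x) \<inter> space \<mu>"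
  shows "(LINT x:S|\<mu>. ln (measure \<mu> (B x))) \<ge> - join_entropy N"
proof (cases "integrable \<mu> (\<lambda>x. indicator S x *\<^sub>R ln (measure \<mu> (B x)))")
  \<comment> \<open>A non-integrable function has integral 0 by convention, and entropy is
    nonnegative.\<close>
  case False
  then have "(LINT x:S|\<mu>. ln (measure \<mu> (B x))) = 0"
    unfolding set_lebesgue_integral_def by (rule not_integrable_integral_eq)
  then show ?thesis using join_entropy_nonneg by simp
next
  case True
  define g where "g x = indicator S x *\<^sub>R ln (measure \<mu> (B x))" for x
  have g: "integrable \<mu> g" using True unfolding g_def .
  have "- join_entropy N = (\<Sum>a\<in>names N. measure \<mu> (cell N a) * ln (measure \<mu> (cell N a)))"
    by (simp add: join_entropy_eq)
  also have "\<dots> \<le> (\<integral>x. g ((f ^^ n) x) \<partial>\<mu>)"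
  proof (rule sum_cells_le_integral[OF integrable_iterate[OF g]])
    show "AE x in \<mu>. \<forall>a\<in>names N. x \<in> cell N a \<longrightarrow> ln (measure \<mu> (cell N a)) \<le> g ((f ^^ n) x)"
      using AE_cell_positive[of N]
    proof (eventually_elim, intro ballI impI)
      fix x a assume pos: "\<forall>a\<in>names N. x \<in> cell N a \<longrightarrow> 0 < measure \<mu> (cell N a)"
        and a: "a \<in> names N" and x: "x \<in> cell N a"
      have p: "measure \<mu> (cell N a) > 0" using pos a x by blast
      have "measure \<mu> (cell N a) \<le> measure \<mu> ((f ^^ n) -` B ((f ^^ n) x) \<inter> space \<mu>)"
        by (rule finite_measure_mono[OF sub[OF a x] measurable_sets[OF measurable_iterate B]])
      also have "\<dots> = measure \<mu> (B ((f ^^ n) x))" by (rule measure_vimage_iterate[OF B])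
      finally have "ln (measure \<mu> (cell N a)) \<le> ln (measure \<mu> (B ((f ^^ n) x)))" using p by simp
      \<comment> \<open>This covers the points whose iterate lies outside \<open>S\<close>, where
        \<open>g\<close> takes the value 0.\<close>
      moreover have "ln (measure \<mu> (cell N a)) \<le> 0" using p by simp
      ultimately show "ln (measure \<mu> (cell N a)) \<le> g ((f ^^ n) x)"
        by (simp add: g_def indicator_def)
    qed
  qed
  also have "\<dots> = (\<integral>x. g x \<partial>\<mu>)" by (rule integral_iterate[OF g])
  finally show ?thesis by (simp add: g_def set_lebesgue_integral_def)
qed

text \<open>
  Jensen's inequality for the logarithm in tangent form: \<open>t / E \<ge> 1 + ln t - ln E\<close>, with \<open>E\<close> the
  exponential of the claimed lower bound.
\<close>

lemma log_integral_powr_ge_join_entropy: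
  assumes B: "\<And>x. B x \<in> sets \<mu>"
    and sub: "\<And>a x. a \<in> names N \<Longrightarrow> x \<in> cell N a \<Longrightarrow> cell N a \<subseteq> (f ^^ n) -` B ((f ^^ n) x) \<inter> space \<mu>"
    and s: "s > 0" and S: "space \<mu> - S \<in> null_sets \<mu>"
  shows "ln (LINT x:S|\<mu>. measure \<mu> (B x) powr s) \<ge> - s * join_entropy N"
proof (cases "integrable \<mu> (\<lambda>x. indicator S x *\<^sub>R measure \<mu> (B x) powr s)")
  case False
  then have "(LINT x:S|\<mu>. measure \<mu> (B x) powr s) = 0"
    unfolding set_lebesgue_integral_def by (rule not_integrable_integral_eq)
  then show ?thesis using join_entropy_nonneg s by simp
next
  case True
  define g where "g x = indicator S x *\<^sub>R measure \<mu> (B x) powr s" for x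
  have g: "integrable \<mu> g" using True unfolding g_def .
  define h where "h = - s * join_entropy N"
  \<comment> \<open>The tangent bound at \<open>E = exp h\<close> for \<open>t\<close> the
    \<open>s\<close>-th power of the measure of the cell. The choice of \<open>h\<close> makes the
    mean of \<open>w\<close> exactly 1, which forces the integral of \<open>g\<close> to be at least
    \<open>exp h\<close>.\<close>
  define w where "w a = 1 + s * ln (measure \<mu> (cell N a)) - h" for a
  \<comment> \<open>Outside \<open>S\<close> the function \<open>g\<close> vanishes and could not
    dominate a positive power, so almost every iterate has to lie in \<open>S\<close>.\<close>
  have "AE x in distr \<mu> \<mu> (f ^^ n). x \<in> S" unfolding distr_iterate
    using AE_not_in[OF S] AE_space by eventually_elim auto
  then have S': "AE x in \<mu>. (f ^^ n) x \<in> S" by (rule AE_distrD[OF measurable_iterate])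
  have "(\<Sum>a\<in>names N. measure \<mu> (cell N a) * w a) =
      (1 - h) * (\<Sum>a\<in>names N. measure \<mu> (cell N a))
        + s * (\<Sum>a\<in>names N. measure \<mu> (cell N a) * ln (measure \<mu> (cell N a)))"
    by (simp add: w_def sum_distrib_left sum.distrib[symmetric] algebra_simps)
  also have "\<dots> = 1 - h - s * join_entropy N" by (simp add: sum_measure_cells join_entropy_eq)
  also have "\<dots> = 1" by (simp add: h_def)
  finally have "1 = (\<Sum>a\<in>names N. measure \<mu> (cell N a) * w a)" ..
  also have "\<dots> \<le> (\<integral>x. g ((f ^^ n) x) / exp h \<partial>\<mu>)"
  proof (rule sum_cells_le_integral)
    show "integrable \<mu> (\<lambda>x. g ((f ^^ n) x) / exp h)" using integrable_iterate[OF g] by simp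
    show "AE x in \<mu>. \<forall>a\<in>names N. x \<in> cell N a \<longrightarrow> w a \<le> g ((f ^^ n) x) / exp h"
      using AE_cell_positive[of N] S'
    proof (eventually_elim, intro ballI impI)
      fix x a assume pos: "\<forall>a\<in>names N. x \<in> cell N a \<longrightarrow> 0 < measure \<mu> (cell N a)"
        and xS: "(f ^^ n) x \<in> S" and a: "a \<in> names N" and x: "x \<in> cell N a"
      have p: "measure \<mu> (cell N a) > 0" using pos a x by blast
      have "measure \<mu> (cell N a) \<le> measure \<mu> ((f ^^ n) -` B ((f ^^ n) x) \<inter> space \<mu>)"
        by (rule finite_measure_mono[OF sub[OF a x] measurable_sets[OF measurable_iterate B]])
      also have "\<dots> = measure \<mu> (B ((f ^^ n) x))" by (rule measure_vimage_iterate[OF B])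
      finally have "measure \<mu> (cell N a) powr s \<le> g ((f ^^ n) x)"
        using xS s by (simp add: g_def powr_mono2)
      then have "measure \<mu> (cell N a) powr s / exp h \<le> g ((f ^^ n) x) / exp h"
        by (intro divide_right_mono) auto
      moreover have "w a \<le> measure \<mu> (cell N a) powr s / exp h"
        using exp_ge_add_one_self[of "s * ln (measure \<mu> (cell N a)) - h"] p
        by (simp add: w_def powr_def exp_diff)
      ultimately show "w a \<le> g ((f ^^ n) x) / exp h" by simp
    qed
  qed
  also have "\<dots> = (\<integral>x. g x \<partial>\<mu>) / exp h" using integral_iterate[OF g] by simp
  finally have "exp h \<le> (\<integral>x. g x \<partial>\<mu>)" by (simp add: field_simps)
  then have "h \<le> ln (\<integral>x. g x \<partial>\<mu>)" by (metis exp_gt_zero ln_exp ln_le_cancel_iff order_less_le_trans)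
  then show ?thesis by (simp add: h_def g_def set_lebesgue_integral_def)
qed

end

section \<open>Positivity of the metric entropy\<close>

lemma metric_entropy_pos:
  assumes X: "compact_space X" and q: "q \<ge> 1"
    and prob: "prob_space \<mu>" and sets: "sets \<mu> = sets (borel_of X)" and inv: "invariant_measure f \<mu>"
    and inj: "inj_on f (topspace X)" and hyp: "hyperbolic_metric X f m"
    and dim: "upper_fractal_dim m \<mu> q > 0"
  shows "metric_entropy \<mu> f > 0"
proof (rule ccontr)
  assume h: "\<not> metric_entropy \<mu> f > 0"
  have m: "mtopology_of m = X" using hyp by (simp add: hyperbolic_metric_def)
  have metr: "metrizable_space X"
    using Metric_space.metrizable_space_mtopology[OF Metric_space_mspace_mdist[of m]] m
    by (simp add: mtopology_of_def)
  have sp: "space \<mu> = topspace X" using sets_eq_imp_space_eq[OF sets] by simp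
  have spm: "mspace m = space \<mu>" using m sp by auto
  obtain k \<epsilon> where k: "k > 1" and \<epsilon>: "\<epsilon> > 0" and expand: "\<And>x y. x \<in> space \<mu> \<Longrightarrow> y \<in> space \<mu> \<Longrightarrow>
      max (mdist m (f x) (f y)) (mdist m (inv_into (space \<mu>) f x) (inv_into (space \<mu>) f y))
        \<ge> min (k * mdist m x y) \<epsilon>"
    using hyp unfolding hyperbolic_metric_def sp by blast
  obtain P where P: "finite P" "P \<subseteq> sets (borel_of X)" "partition_on (topspace X) P"
    and small: "\<forall>A\<in>P. \<forall>x\<in>A. \<forall>y\<in>A. mdist m x y < \<epsilon>"
    using obtain_small_borel_partition[OF X m \<epsilon>] .
  have diam: "mdist m x y < \<epsilon>" if "A \<in> P" "x \<in> A" "y \<in> A" for A x y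
    using small that by blast
  interpret prob_space \<mu> by (rule prob)
  interpret partitioned_system \<mu> f P
    using P inv sets sp by unfold_locales auto
  \<comment> \<open>Metric entropy is a supremum over partitions, so if it is not positive, the
    entropy rate of this one partition is at most 0.\<close>
  have H: "limsup (\<lambda>n. ereal (join_entropy n / real n)) \<le> 0"
  proof -
    have "limsup (\<lambda>n. ereal (join_entropy n / real n)) \<le> metric_entropy \<mu> f"
      unfolding metric_entropy_def
      by (rule SUP_upper2[of P]) (use finite_P P_sets P_partition in auto)
    with h show ?thesis by (simp add: not_less)
  qed
  let ?S = "topological_support (mtopology_of m) \<mu>"
  have S: "space \<mu> - ?S \<in> null_sets \<mu>"
    using null_sets_complement_support[OF X metr finite_measure_axioms sets] m sp by simp
  have B: "mball_of m x r \<in> sets \<mu>" for x r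
    using openin_mball_of m sets openin_sets_borel_of by metis
  have sub: "cell (2 * n + 1) a \<subseteq> (f ^^ n) -` mball_of m ((f ^^ n) x) r \<inter> space \<mu>"
    if "r * k ^ n > \<epsilon>" "a \<in> names (2 * n + 1)" "x \<in> cell (2 * n + 1) a" for r n a x
    using inj by (intro cell_subset_vimage_ball[OF _ spm k expand diam that(2,3,1)]) (simp_all add: sp)
  show False
  proof (cases "q = 1")
    case True
    have "upper_fractal_dim m \<mu> q = Limsup (at_right 0)
      (\<lambda>r. ereal ((LINT x:?S|\<mu>. ln (measure \<mu> (mball_of m x r))) / ln r))"
      using True by (simp add: upper_fractal_dim_def)
    also have "\<dots> \<le> 0"
    proof (rule Limsup_scaled_log_nonpos[OF k \<epsilon> _ H])
      fix n r assume "r * k ^ n > \<epsilon>"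
      then show "(LINT x:?S|\<mu>. ln (measure \<mu> (mball_of m x r))) \<ge> - join_entropy (2 * n + 1)"
        by (intro integral_log_ge_join_entropy[where n = n] B sub)
    qed
    finally show False using dim by simp
  next
    case False
    with q have q1: "q - 1 > 0" by simp
    let ?J = "\<lambda>r. ln (LINT x:?S|\<mu>. measure \<mu> (mball_of m x r) powr (q - 1))"
    have "upper_fractal_dim m \<mu> q = Limsup (at_right 0) (\<lambda>r. ereal (?J r / (q - 1) / ln r))"
      using False by (simp add: upper_fractal_dim_def)
    also have "\<dots> \<le> 0"
    proof (rule Limsup_scaled_log_nonpos[OF k \<epsilon> _ H])
      fix n r assume "r * k ^ n > \<epsilon>"
      \<comment> \<open>Jensen's inequality costs the factor \<open>q - 1\<close>, which the
        denominator in the definition of the dimension cancels. What remains is the bound of the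
        case \<open>q = 1\<close>.\<close>
      then have "?J r \<ge> - (q - 1) * join_entropy (2 * n + 1)"
        by (intro log_integral_powr_ge_join_entropy[where n = n] B sub q1 S)
      then show "?J r / (q - 1) \<ge> - join_entropy (2 * n + 1)" using q1 by (simp add: field_simps)
    qed
    finally show False using dim by simp
  qed
qed

theorem corollary1p3:
  fixes X :: "'a topology" and f :: "'a \<Rightarrow> 'a" and q :: real
    and \<mu> :: "'a measure" and m :: "'a metric"
  assumes "compact_space X" and "metrizable_space X"
    and "expansive_homeomorphism X f"
    and "q \<ge> 1"
    and "prob_space \<mu>" and "sets \<mu> = sets (borel_of X)"
    and "invariant_measure f \<mu>"
    and "hyperbolic_metric X f m"
    and "upper_fractal_dim m \<mu> q > 0"
  shows "topological_entropy X f \<ge> metric_entropy \<mu> f \<and> metric_entropy \<mu> f > 0"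
proof
  show "metric_entropy \<mu> f \<le> topological_entropy X f"
    using assms by (intro metric_entropy_le_topological_entropy)
  have "inj_on f (topspace X)"
    using assms(3) by (simp add: expansive_homeomorphism_def homeomorphic_eq_everything_map)
  then show "metric_entropy \<mu> f > 0"
    using assms by (intro metric_entropy_pos)
qed

end
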